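(* Let $C\in\{1,\dots,m\}$ and consider the maximum capture problem under generalized extreme value (GEV) models with a cardinality constraint, $$\max\{f^{\mathrm{GEV}}(S):\ S\subseteq[m],\ |S|\le C\},\qquad f^{\mathrm{GEV}}(S)=\sum_{i\in I}q_i-\sum_{i\in I}\frac{q_i}{1+G^i(\mathbf{Y}^i|S)}.$$ Then the greedy heuristic returns a $(1-1/e)$-approximate solution: any set $\overline{S}$ it returns satisfies $$f^{\mathrm{GEV}}(\overline{S})\ \ge\ (1-1/e)\max_{S\subseteq[m],\,|S|\le C}f^{\mathrm{GEV}}(S).$$
   Context: Let $[m]=\{1,\dots,m\}$ be the set of candidate locations, and $I$ a finite nonempty set of customer zones. Zone $i\in I$ has $q_i>0$ customers, with deterministic utilities $v_{ij}\in\mathbb{R}$ for $j\in[m]$; let $\mathbf{Y}^i\in\mathbb{R}^m$ have entries $Y^i_j=e^{v_{ij}}>0$. Each zone $i$ has a choice probability generating function (CPGF) $G^i$ of a GEV model. A CPGF is a function $G:\mathbb{R}^m_+\to\mathbb{R}$ on the closed nonnegative orthant, continuous on $\mathbb{R}^m_+$ and possessing continuous mixed partial derivatives of all orders on the open positive orthant (where $\partial G_{j_1\dots j_k}$ denotes the mixed partial derivative with respect to $Y_{j_1},\dots,Y_{j_k}$), such that: (i) $G(\mathbf{Y})\ge 0$ for all $\mathbf{Y}\in\mathbb{R}^m_+$; (ii) $G(\lambda\mathbf{Y})=\lambda G(\mathbf{Y})$ for all $\lambda>0$; (iii) $G(\mathbf{Y})\to\infty$ if $Y_j\to\infty$ for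 some $j$; (iv) on the open positive orthant, for distinct $j_1,\dots,j_k\in[m]$: $\partial G_{j_1}(\mathbf{Y})>0$ when $k=1$, $\partial G_{j_1\dots j_k}(\mathbf{Y})\ge 0$ when $k\geq 3$ is odd, and $\partial G_{j_1\dots j_k}(\mathbf{Y})\le 0$ when $k$ is even; (v) $G(\mathbf{Y})=\sum_{j\in[m]}Y_j\,\partial G_j(\mathbf{Y})$ on the open positive orthant; (vi) $\sum_{k\in[m]}Y_k\,\partial G_{jk}(\mathbf{Y})=0$ for all $j\in[m]$ on the open positive orthant. For $S\subseteq[m]$, $G^i(\mathbf{Y}^i|S):=G^i(\widetilde{\mathbf{Y}}^i)$, where $\widetilde Y^i_j=Y^i_j$ if $j\in S$ and $\widetilde Y^i_j=0$ otherwise. The quantity $f^{\mathrm{GEV}}(S)$ is the expected captured demand when facilities are opened at $S$ (the competitors' total utility being normalized to $1$). Greedy heuristic: start with $S=\emptyset$; repeat $C$ times: choose $j^*\in\arg\max_{j\in[m]\setminus S}f^{\mathrm{GEV}}(S\cup\{j\})$ (ties broken arbitrarily) and replace $S$ by $S\cup\{j^*\}$; return $\overline{S}=S$. *)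

theory Defs
  imports "HOL-Analysis.Analysis"
begin

text \<open>
  The candidate locations are the elements of a finite type \<open>'m\<close>, so \<open>m\<close> is \<open>CARD('m)\<close> and
  utility vectors live in \<open>real ^ 'm\<close>.
\<close>

definition nonneg_orthant :: "(real ^ 'm) set" where
  "nonneg_orthant = {Y. \<forall>j. 0 \<le> Y $ j}"

definition pos_orthant :: "(real ^ 'm) set" where
  "pos_orthant = {Y. \<forall>j. 0 < Y $ j}"

definition partial_deriv :: "'m \<Rightarrow> (real ^ 'm \<Rightarrow> real) \<Rightarrow> real ^ 'm \<Rightarrow> real" where
  "partial_deriv j F Y = deriv (\<lambda>t. F (Y + t *\<^sub>R axis j 1)) 0"

text \<open>
  \<open>mixed_partial [j1, \<dots>, jk] F\<close> differentiates with respect to coordinate \<open>j1\<close> first.  Since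
  \<open>deriv\<close> is total, its values are meaningful only where the derivatives exist; this is what
  \<open>smooth_on_pos\<close> guarantees.  Indices may repeat.
\<close>

definition mixed_partial :: "'m list \<Rightarrow> (real ^ 'm \<Rightarrow> real) \<Rightarrow> real ^ 'm \<Rightarrow> real" where
  "mixed_partial js F = fold partial_deriv js F"

definition smooth_on_pos :: "(real ^ 'm \<Rightarrow> real) \<Rightarrow> bool" where
  "smooth_on_pos F \<longleftrightarrow>
     (\<forall>js. continuous_on pos_orthant (mixed_partial js F) \<and>
       (\<forall>j. \<forall>Y\<in>pos_orthant. (\<lambda>t. mixed_partial js F (Y + t *\<^sub>R axis j 1)) differentiable (at 0)))"

text \<open>
  Only the values of \<open>G\<close> on the nonnegative orthant matter.  In the limit condition, \<open>Y\<close> ranges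
  over the nonnegative orthant with \<open>Y $ j\<close> tending to infinity, the other coordinates being
  unrestricted.
\<close>

definition cpgf :: "(real ^ 'm \<Rightarrow> real) \<Rightarrow> bool" where
  "cpgf G \<longleftrightarrow>
     continuous_on nonneg_orthant G \<and>
     smooth_on_pos G \<and>
     (\<forall>Y\<in>nonneg_orthant. 0 \<le> G Y) \<and>
     (\<forall>Y\<in>nonneg_orthant. \<forall>c>0. G (c *\<^sub>R Y) = c * G Y) \<and>
     (\<forall>j. filterlim G at_top (inf (filtercomap (\<lambda>Y. Y $ j) at_top) (principal nonneg_orthant))) \<and>
     (\<forall>Y\<in>pos_orthant. \<forall>js. distinct js \<longrightarrow>
        (length js = 1 \<longrightarrow> 0 < mixed_partial js G Y) \<and>
        (3 \<le> length js \<and> odd (length js) \<longrightarrow> 0 \<le> mixed_partial js G Y) \<and>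
        (js \<noteq> [] \<and> even (length js) \<longrightarrow> mixed_partial js G Y \<le> 0)) \<and>
     (\<forall>Y\<in>pos_orthant. G Y = (\<Sum>j\<in>UNIV. Y $ j * mixed_partial [j] G Y)) \<and>
     (\<forall>Y\<in>pos_orthant. \<forall>j. (\<Sum>k\<in>UNIV. Y $ k * mixed_partial [j, k] G Y) = 0)"

definition restrict_to :: "'m set \<Rightarrow> real ^ 'm \<Rightarrow> real ^ 'm" where
  "restrict_to S Y = (\<chi> j. if j \<in> S then Y $ j else 0)"

definition f_gev ::
  "'i set \<Rightarrow> ('i \<Rightarrow> real) \<Rightarrow> ('i \<Rightarrow> 'm \<Rightarrow> real) \<Rightarrow> ('i \<Rightarrow> real ^ 'm \<Rightarrow> real) \<Rightarrow> 'm set \<Rightarrow> real" where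
  "f_gev I q v G S =
     (\<Sum>i\<in>I. q i) - (\<Sum>i\<in>I. q i / (1 + G i (restrict_to S (\<chi> j. exp (v i j)))))"

text \<open>
  \<open>greedy f n S\<close>: some run of the greedy heuristic for \<open>f\<close>, with some way of breaking ties, holds
  \<open>S\<close> after \<open>n\<close> iterations.
\<close>

inductive greedy :: "('m set \<Rightarrow> real) \<Rightarrow> nat \<Rightarrow> 'm set \<Rightarrow> bool" for f where
  start: "greedy f 0 {}"
| step: "greedy f n S \<Longrightarrow> is_arg_max (\<lambda>j. f (insert j S)) (\<lambda>j. j \<notin> S) j \<Longrightarrow>
    greedy f (Suc n) (insert j S)"

lemma greedy_finite_card: "greedy f n S \<Longrightarrow> finite S \<and> card S = n"
  by (induction rule: greedy.induct) (auto simp: is_arg_max_def)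

lemma greedy_exists:
  fixes f :: "'m::finite set \<Rightarrow> real"
  assumes "n \<le> CARD('m)"
  shows "\<exists>S. greedy f n S"
  using assms
proof (induction n)
  case 0
  show ?case by (blast intro: greedy.start)
next
  case (Suc n)
  then obtain S where S: "greedy f n S" by auto
  have "card S < CARD('m)" using greedy_finite_card[OF S] Suc.prems by simp
  then have ne: "- S \<noteq> {}" by (metis Compl_eq_Diff_UNIV Diff_eq_empty_iff less_irrefl top.extremum_unique)
  have "finite ((\<lambda>j. f (insert j S)) ` (- S))" by simp
  then have "Max ((\<lambda>j. f (insert j S)) ` (- S)) \<in> (\<lambda>j. f (insert j S)) ` (- S)"
    using ne by (intro Max_in) auto
  then obtain j where j: "j \<notin> S" "f (insert j S) = Max ((\<lambda>j. f (insert j S)) ` (- S))" by auto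
  have "is_arg_max (\<lambda>j. f (insert j S)) (\<lambda>j. j \<notin> S) j"
    unfolding is_arg_max_linorder using j by (auto intro!: Max_ge)
  then show ?case using greedy.step[OF S] by blast
qed

end

theory Submission
  imports Defs
begin

text \<open>
  The captured demand \<open>f_gev\<close> is a monotone submodular set function with nonnegative values, and
  for such functions the greedy bound is the classical argument of Nemhauser, Wolsey and Fisher.

  Submodularity comes from the signs of two families of partial derivatives of a CPGF \<open>G\<close>.  As
  \<open>\<partial>\<^sub>j G > 0\<close>, raising a coordinate raises \<open>G\<close>; as \<open>\<partial>\<^sub>k (\<partial>\<^sub>j G) \<le> 0\<close> for \<open>j \<noteq> k\<close>, the increase
  obtained from coordinate \<open>k\<close> shrinks when coordinate \<open>j\<close> is raised
  (\<open>cpgf_add_axis_mono_pos\<close>, \<open>cpgf_add_axis_submodular_pos\<close>).  Opening a facility raises one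
  coordinate of the restricted utility vector, but this vector lies on the boundary of the orthant,
  where \<open>G\<close> has no derivatives.  Both inequalities pass to the boundary because \<open>G\<close> is continuous
  there, by shifting every coordinate by a small positive amount.

  A zone contributes \<open>q (1 - 1 / (1 + G))\<close>, an increasing concave function of \<open>G\<close>, and such a
  function of a monotone submodular function is again monotone submodular
  (\<open>reciprocal_decreasing_differences\<close>).

  For the greedy bound, let \<open>T\<close> have at most \<open>C\<close> elements.  By submodularity, the gains from adding
  the elements of \<open>T\<close> one by one to the current set \<open>S\<close> alone sum to at least \<open>f T - f S\<close>, so the
  best single element closes at least the fraction \<open>1 / C\<close> of this gap.  After \<open>C\<close> iterations the
  gap has shrunk by the factor \<open>(1 - 1 / C) ^ C \<le> 1 / e\<close>.
\<close>

section \<open>Greedy maximization of monotone submodular set functions\<close>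

text \<open>
  The second-difference form of submodularity is what second derivatives deliver.  On finite sets it
  is equivalent to \<open>F (A \<union> B) + F (A \<inter> B) \<le> F A + F B\<close>.
\<close>

definition submodular :: "('a set \<Rightarrow> real) \<Rightarrow> bool" where
  "submodular F \<longleftrightarrow>
     (\<forall>S j k. j \<notin> S \<longrightarrow> k \<notin> S \<longrightarrow> j \<noteq> k \<longrightarrow>
        F (insert j (insert k S)) + F S \<le> F (insert j S) + F (insert k S))"

lemma submodular_diminishing_returns:
  assumes "submodular F" and "finite R" and "j \<notin> S \<union> R"
  shows "F (insert j (S \<union> R)) - F (S \<union> R) \<le> F (insert j S) - F S"
  using assms(2,3)
proof (induction R rule: finite_induct)
  case empty
  then show ?case by simp
next
  case (insert k R)
  show ?case
  proof (cases "k \<in> S")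
    case True
    then have "S \<union> insert k R = S \<union> R" by auto
    then show ?thesis using insert by simp
  next
    case False
    then have "F (insert j (insert k (S \<union> R))) + F (S \<union> R)
        \<le> F (insert j (S \<union> R)) + F (insert k (S \<union> R))"
      using assms(1) insert.hyps insert.prems unfolding submodular_def by auto
    then show ?thesis using insert by auto
  qed
qed

text \<open>
  Adding the elements of \<open>T\<close> one after the other, each gains at most what it would gain when added
  to \<open>S\<close> alone.
\<close>

lemma submodular_union_bound:
  assumes "submodular F" and "finite T" and "T \<inter> S = {}"
  shows "F (S \<union> T) \<le> F S + (\<Sum>j\<in>T. F (insert j S) - F S)"
  using assms(2,3)
proof (induction T rule: finite_induct)
  case empty
  then show ?case by simp
next
  case (insert k T)
  have "F (insert k (S \<union> T)) - F (S \<union> T) \<le> F (insert k S) - F S"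
    using insert by (intro submodular_diminishing_returns[OF assms(1)]) auto
  then show ?case using insert by simp
qed

text \<open>
  At most \<open>C\<close> elements of \<open>T\<close> are missing from \<open>S\<close>, and each of them gains at most as much as \<open>j\<close>.
  Monotonicity makes the gain of \<open>j\<close> nonnegative, so that their number can be rounded up to \<open>C\<close>.
\<close>

lemma greedy_step_gain:
  assumes "mono F" and "submodular F" and "finite T" and "card T \<le> C"
    and "is_arg_max (\<lambda>j. F (insert j S)) (\<lambda>j. j \<notin> S) j"
  shows "F T - F S \<le> real C * (F (insert j S) - F S)"
proof -
  have "F T \<le> F (S \<union> (T - S))"
    using assms(1) by (intro monoD[of F]) auto
  also have "\<dots> \<le> F S + (\<Sum>k\<in>T - S. F (insert k S) - F S)"
    using assms(2,3) by (intro submodular_union_bound) auto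
  also have "\<dots> \<le> F S + (\<Sum>k\<in>T - S. F (insert j S) - F S)"
    using assms(5) by (intro add_left_mono sum_mono) (auto simp: is_arg_max_linorder)
  also have "\<dots> = F S + real (card (T - S)) * (F (insert j S) - F S)"
    by simp
  also have "\<dots> \<le> F S + real C * (F (insert j S) - F S)"
  proof -
    have "card (T - S) \<le> C"
      using assms(3,4) by (meson Diff_subset card_mono le_trans)
    moreover have "F S \<le> F (insert j S)"
      using assms(1) by (intro monoD[of F]) auto
    ultimately show ?thesis by (intro add_left_mono mult_right_mono) auto
  qed
  finally show ?thesis by simp
qed

text \<open>
  Each iteration leaves at most the fraction \<open>1 - 1 / C\<close> of the gap, against the same competitor \<open>T\<close>.
\<close>

lemma greedy_gap:
  assumes "mono F" and "submodular F" and "finite T" and "card T \<le> C" and "1 \<le> C"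
    and "greedy F n S"
  shows "F T - F S \<le> (1 - 1 / real C) ^ n * (F T - F {})"
  using assms(6)
proof (induction rule: greedy.induct)
  case start
  then show ?case by simp
next
  case (step n S j)
  have "F T - F S \<le> real C * (F (insert j S) - F S)"
    using greedy_step_gain assms(1-4) step.hyps(2) .
  then have "F T - F (insert j S) \<le> (1 - 1 / real C) * (F T - F S)"
    using assms(5) by (simp add: field_simps)
  also have "\<dots> \<le> (1 - 1 / real C) * ((1 - 1 / real C) ^ n * (F T - F {}))"
    using step.IH assms(5) by (intro mult_left_mono) auto
  finally show ?case by simp
qed

lemma greedy_approximation:
  assumes "mono F" and "submodular F" and "0 \<le> F {}"
    and "finite T" and "card T \<le> C" and "1 \<le> C" and "greedy F C S"
  shows "(1 - 1 / exp 1) * F T \<le> F S"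
proof -
  have "(1 - 1 / real C) ^ C \<le> exp (- 1 / real C) ^ C"
    using exp_ge_add_one_self[of "- 1 / real C"] assms(6) by (intro power_mono) auto
  also have "\<dots> = exp (real C * (- 1 / real C))"
    by (rule exp_of_nat_mult[symmetric])
  also have "\<dots> = 1 / exp 1"
    using assms(6) by (simp add: exp_minus inverse_eq_divide)
  finally have factor: "(1 - 1 / real C) ^ C \<le> 1 / exp 1" .
  have "F {} \<le> F T"
    using assms(1) by (intro monoD[of F]) auto
  have "F T - F S \<le> (1 - 1 / real C) ^ C * (F T - F {})"
    using greedy_gap assms(1,2,4-7) .
  also have "\<dots> \<le> 1 / exp 1 * (F T - F {})"
    using factor \<open>F {} \<le> F T\<close> by (intro mult_right_mono) auto
  also have "\<dots> \<le> 1 / exp 1 * F T"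
    using assms(3) by (intro mult_left_mono) auto
  finally show ?thesis by (simp add: algebra_simps)
qed

section \<open>Differences of a choice probability generating function\<close>

lemma pos_orthant_add_axis:
  assumes "Y \<in> pos_orthant" and "0 \<le> t"
  shows "Y + t *\<^sub>R axis j 1 \<in> pos_orthant"
  using assms by (auto simp: pos_orthant_def axis_def add_pos_nonneg)

lemma mixed_partial_has_deriv:
  assumes "smooth_on_pos F" and "Y \<in> pos_orthant" and "0 \<le> t"
  shows "((\<lambda>s. mixed_partial js F (Y + s *\<^sub>R axis j 1)) has_real_derivative
      mixed_partial (js @ [j]) F (Y + t *\<^sub>R axis j 1)) (at t)"
proof -
  let ?f = "\<lambda>s. mixed_partial js F (Y + t *\<^sub>R axis j 1 + s *\<^sub>R axis j 1)"
  have "?f differentiable (at 0)"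
    using assms pos_orthant_add_axis unfolding smooth_on_pos_def by blast
  then have "(?f has_real_derivative deriv ?f 0) (at 0)"
    by (simp add: DERIV_deriv_iff_real_differentiable)
  moreover have "deriv ?f 0 = mixed_partial (js @ [j]) F (Y + t *\<^sub>R axis j 1)"
    by (simp add: mixed_partial_def partial_deriv_def)
  moreover have "?f = (\<lambda>s. mixed_partial js F (Y + (s + t) *\<^sub>R axis j 1))"
    by (simp add: algebra_simps)
  ultimately show ?thesis
    using DERIV_shift[of "\<lambda>s. mixed_partial js F (Y + s *\<^sub>R axis j 1)" _ 0 t] by simp
qed

lemma cpgf_first_partial_pos:
  assumes "cpgf G" and "Y \<in> pos_orthant"
  shows "0 < mixed_partial [j] G Y"
proof -
  have "distinct [j]" "length [j] = 1" by simp_all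
  then show ?thesis using assms unfolding cpgf_def by blast
qed

lemma cpgf_second_partial_nonpos:
  assumes "cpgf G" and "Y \<in> pos_orthant" and "j \<noteq> k"
  shows "mixed_partial [j, k] G Y \<le> 0"
proof -
  have "distinct [j, k]" "[j, k] \<noteq> []" "even (length [j, k])" using assms(3) by simp_all
  then show ?thesis using assms(1,2) unfolding cpgf_def by blast
qed

lemma cpgf_add_axis_mono_pos:
  assumes "cpgf G" and "Y \<in> pos_orthant" and "0 \<le> t"
  shows "G Y \<le> G (Y + t *\<^sub>R axis j 1)"
proof -
  have smooth: "smooth_on_pos G" using assms(1) by (simp add: cpgf_def)
  have "G (Y + 0 *\<^sub>R axis j 1) \<le> G (Y + t *\<^sub>R axis j 1)"
  proof (rule DERIV_nonneg_imp_nondecreasing[OF assms(3)])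
    fix s :: real assume "0 \<le> s" "s \<le> t"
    then show "\<exists>y. ((\<lambda>s. G (Y + s *\<^sub>R axis j 1)) has_real_derivative y) (at s) \<and> 0 \<le> y"
      using mixed_partial_has_deriv[OF smooth assms(2), of s "[]" j]
        cpgf_first_partial_pos[OF assms(1) pos_orthant_add_axis[OF assms(2)], of s j j]
      by (auto simp: mixed_partial_def intro: less_imp_le)
  qed
  then show ?thesis by simp
qed

lemma cpgf_partial_decreasing:
  assumes "cpgf G" and "Y \<in> pos_orthant" and "0 \<le> t" and "j \<noteq> k"
  shows "mixed_partial [j] G (Y + t *\<^sub>R axis k 1) \<le> mixed_partial [j] G Y"
proof -
  have smooth: "smooth_on_pos G" using assms(1) by (simp add: cpgf_def)
  have "mixed_partial [j] G (Y + t *\<^sub>R axis k 1) \<le> mixed_partial [j] G (Y + 0 *\<^sub>R axis k 1)"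
  proof (rule DERIV_nonpos_imp_nonincreasing[OF assms(3)])
    fix s :: real assume "0 \<le> s" "s \<le> t"
    then show "\<exists>y. ((\<lambda>s. mixed_partial [j] G (Y + s *\<^sub>R axis k 1)) has_real_derivative y) (at s)
        \<and> y \<le> 0"
      using mixed_partial_has_deriv[OF smooth assms(2), of s "[j]" k]
        cpgf_second_partial_nonpos[OF assms(1) pos_orthant_add_axis[OF assms(2)] assms(4)]
      by auto
  qed
  then show ?thesis by simp
qed

text \<open>
  The gain from raising coordinate \<open>k\<close>, viewed as a function of the amount by which coordinate \<open>j\<close>
  is raised, has as derivative a difference of two values of \<open>\<partial>\<^sub>j G\<close>; this is nonpositive because
  \<open>\<partial>\<^sub>j G\<close> decreases in direction \<open>k\<close>.
\<close>

lemma cpgf_add_axis_submodular_pos: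
  assumes "cpgf G" and "Y \<in> pos_orthant" and "0 \<le> s" and "0 \<le> t" and "j \<noteq> k"
  shows "G (Y + s *\<^sub>R axis j 1 + t *\<^sub>R axis k 1) + G Y
    \<le> G (Y + s *\<^sub>R axis j 1) + G (Y + t *\<^sub>R axis k 1)"
proof -
  let ?Z = "Y + t *\<^sub>R axis k 1"
  let ?gain = "\<lambda>r. G (?Z + r *\<^sub>R axis j 1) - G (Y + r *\<^sub>R axis j 1)"
  have smooth: "smooth_on_pos G" using assms(1) by (simp add: cpgf_def)
  have Z: "?Z \<in> pos_orthant" using assms(2,4) by (rule pos_orthant_add_axis)
  have "?gain s \<le> ?gain 0"
  proof (rule DERIV_nonpos_imp_nonincreasing[OF assms(3)])
    fix r :: real assume r: "0 \<le> r" "r \<le> s"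
    let ?d = "mixed_partial [j] G (?Z + r *\<^sub>R axis j 1) - mixed_partial [j] G (Y + r *\<^sub>R axis j 1)"
    have "(?gain has_real_derivative ?d) (at r)"
      using mixed_partial_has_deriv[OF smooth Z r(1), of "[]" j]
        mixed_partial_has_deriv[OF smooth assms(2) r(1), of "[]" j]
      by (intro DERIV_diff) (simp_all add: mixed_partial_def)
    moreover have "?d \<le> 0"
      using cpgf_partial_decreasing[OF assms(1) pos_orthant_add_axis[OF assms(2) r(1)] assms(4,5)]
      by (simp add: algebra_simps)
    ultimately show "\<exists>y. (?gain has_real_derivative y) (at r) \<and> y \<le> 0" by blast
  qed
  then show ?thesis by (simp add: algebra_simps)
qed

section \<open>Passage to the boundary of the orthant\<close>

lemma cpgf_shift_tendsto:
  fixes Y :: "real ^ 'm"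
  assumes "cpgf G" and "Y \<in> nonneg_orthant"
  shows "(\<lambda>n. G (Y + inverse (real (Suc n)) *\<^sub>R 1)) \<longlonglongrightarrow> G Y"
proof -
  have "(\<lambda>n. Y + inverse (real (Suc n)) *\<^sub>R 1) \<longlonglongrightarrow> Y + 0 *\<^sub>R 1"
    by (intro tendsto_intros LIMSEQ_inverse_real_of_nat)
  moreover have "Y + inverse (real (Suc n)) *\<^sub>R 1 \<in> nonneg_orthant" for n
    using assms(2) by (simp add: nonneg_orthant_def)
  moreover have "continuous_on nonneg_orthant G" using assms(1) by (simp add: cpgf_def)
  ultimately show ?thesis
    using assms(2) by (auto intro!: continuous_on_tendsto_compose[where f = G])
qed

lemma shift_in_pos_orthant:
  "Y \<in> nonneg_orthant \<Longrightarrow> Y + inverse (real (Suc n)) *\<^sub>R 1 \<in> pos_orthant"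
  by (simp add: nonneg_orthant_def pos_orthant_def add_nonneg_pos)

lemma nonneg_orthant_add_axis:
  assumes "Y \<in> nonneg_orthant" and "0 \<le> t"
  shows "Y + t *\<^sub>R axis j 1 \<in> nonneg_orthant"
  using assms by (auto simp: nonneg_orthant_def axis_def)

text \<open>
  At the empty set of facilities every coordinate is zero, so the two inequalities are needed on the
  closed orthant; weak inequalities survive the limit of the shifted vectors.
\<close>

lemma cpgf_add_axis_mono:
  assumes "cpgf G" and "Y \<in> nonneg_orthant" and "0 \<le> t"
  shows "G Y \<le> G (Y + t *\<^sub>R axis j 1)"
proof (rule LIMSEQ_le[OF cpgf_shift_tendsto cpgf_shift_tendsto])
  show "\<exists>N. \<forall>n\<ge>N. G (Y + inverse (real (Suc n)) *\<^sub>R 1)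
      \<le> G (Y + t *\<^sub>R axis j 1 + inverse (real (Suc n)) *\<^sub>R 1)"
    using cpgf_add_axis_mono_pos[OF assms(1) shift_in_pos_orthant[OF assms(2)] assms(3), of _ j]
    by (simp add: add_ac)
qed (use assms nonneg_orthant_add_axis in auto)

lemma cpgf_add_axis_submodular:
  assumes "cpgf G" and "Y \<in> nonneg_orthant" and "0 \<le> s" and "0 \<le> t" and "j \<noteq> k"
  shows "G (Y + s *\<^sub>R axis j 1 + t *\<^sub>R axis k 1) + G Y
    \<le> G (Y + s *\<^sub>R axis j 1) + G (Y + t *\<^sub>R axis k 1)"
proof (rule LIMSEQ_le[OF tendsto_add[OF cpgf_shift_tendsto cpgf_shift_tendsto]
      tendsto_add[OF cpgf_shift_tendsto cpgf_shift_tendsto]])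
  let ?e = "\<lambda>n. inverse (real (Suc n)) *\<^sub>R 1"
  show "\<exists>N. \<forall>n\<ge>N. G (Y + s *\<^sub>R axis j 1 + t *\<^sub>R axis k 1 + ?e n) + G (Y + ?e n)
      \<le> G (Y + s *\<^sub>R axis j 1 + ?e n) + G (Y + t *\<^sub>R axis k 1 + ?e n)"
    using cpgf_add_axis_submodular_pos[OF assms(1) shift_in_pos_orthant[OF assms(2)] assms(3-5)]
    by (simp add: add_ac)
qed (auto intro!: assms(1-4) nonneg_orthant_add_axis)

section \<open>The captured demand as a set function\<close>

lemma restrict_to_nonneg:
  "Y \<in> nonneg_orthant \<Longrightarrow> restrict_to S Y \<in> nonneg_orthant"
  by (simp add: nonneg_orthant_def restrict_to_def)

lemma restrict_to_insert:
  "j \<notin> S \<Longrightarrow> restrict_to (insert j S) Y = restrict_to S Y + (Y $ j) *\<^sub>R axis j 1"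
  by (auto simp: restrict_to_def axis_def vec_eq_iff)

lemma cpgf_restrict_insert_mono:
  assumes "cpgf G" and "Y \<in> nonneg_orthant"
  shows "G (restrict_to S Y) \<le> G (restrict_to (insert j S) Y)"
proof (cases "j \<in> S")
  case True
  then show ?thesis by (simp add: insert_absorb)
next
  case False
  have "0 \<le> Y $ j" using assms(2) by (simp add: nonneg_orthant_def)
  then show ?thesis
    using cpgf_add_axis_mono[OF assms(1) restrict_to_nonneg[OF assms(2)]]
    by (simp add: restrict_to_insert[OF False])
qed

lemma submodular_cpgf_restrict:
  fixes Y :: "real ^ 'm"
  assumes "cpgf G" and "Y \<in> nonneg_orthant"
  shows "submodular (\<lambda>S. G (restrict_to S Y))"
  unfolding submodular_def
proof (intro allI impI)
  fix S :: "'m set" and j k :: 'm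
  assume jk: "j \<notin> S" "k \<notin> S" "j \<noteq> k"
  have "0 \<le> Y $ j" "0 \<le> Y $ k" using assms(2) by (simp_all add: nonneg_orthant_def)
  then show "G (restrict_to (insert j (insert k S)) Y) + G (restrict_to S Y)
      \<le> G (restrict_to (insert j S) Y) + G (restrict_to (insert k S) Y)"
    using cpgf_add_axis_submodular[OF assms(1) restrict_to_nonneg[OF assms(2)], of "Y $ k" "Y $ j" k j]
      jk by (simp add: restrict_to_insert add_ac)
qed

lemma mono_if_insert:
  fixes F :: "'a::finite set \<Rightarrow> real"
  assumes "\<And>S j. F S \<le> F (insert j S)"
  shows "mono F"
proof (rule monoI)
  fix A B :: "'a set" assume "A \<subseteq> B"
  have "F A \<le> F (A \<union> R)" for R
    using finite[of R]
  proof (induction R rule: finite_induct)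
    case (insert j R)
    then show ?case using assms[of "A \<union> R" j] by simp
  qed simp
  then show "F A \<le> F B" using \<open>A \<subseteq> B\<close> by (metis Un_absorb1)
qed

text \<open>
  In the application \<open>a, b, c, d\<close> are the values at \<open>S\<close>, \<open>S \<union> {j}\<close>, \<open>S \<union> {k}\<close>, \<open>S \<union> {j, k}\<close> of a monotone
  submodular function.  The two sides are \<open>(d - c) / ((1 + c) (1 + d))\<close> and
  \<open>(b - a) / ((1 + a) (1 + b))\<close>: the left one has the smaller numerator and the larger denominator.
\<close>

lemma reciprocal_decreasing_differences:
  fixes a b c d :: real
  assumes "0 \<le> a" "a \<le> b" "a \<le> c" "b \<le> d" "c \<le> d" "d + a \<le> b + c"
  shows "1 / (1 + c) - 1 / (1 + d) \<le> 1 / (1 + a) - 1 / (1 + b)"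
proof -
  have "1 / (1 + c) - 1 / (1 + d) = (d - c) / ((1 + c) * (1 + d))"
    using assms by (simp add: field_simps)
  also have "\<dots> \<le> (b - a) / ((1 + a) * (1 + b))"
    using assms by (intro frac_le mult_mono mult_pos_pos) auto
  also have "\<dots> = 1 / (1 + a) - 1 / (1 + b)"
    using assms by (simp add: field_simps)
  finally show ?thesis .
qed

text \<open>
  The probability of capturing a customer is \<open>1 - 1 / (1 + g S)\<close>; its additive constant cancels in
  second differences and is left out.
\<close>

lemma submodular_saturation:
  fixes g :: "'a set \<Rightarrow> real"
  assumes "submodular g" and "\<And>S. 0 \<le> g S" and "\<And>S j. g S \<le> g (insert j S)"
  shows "submodular (\<lambda>S. - (1 / (1 + g S)))"
  unfolding submodular_def
proof (intro allI impI)
  fix S :: "'a set" and j k :: 'a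
  assume jk: "j \<notin> S" "k \<notin> S" "j \<noteq> k"
  have "1 / (1 + g (insert k S)) - 1 / (1 + g (insert j (insert k S)))
      \<le> 1 / (1 + g S) - 1 / (1 + g (insert j S))"
  proof (rule reciprocal_decreasing_differences)
    show "g (insert j S) \<le> g (insert j (insert k S))"
      using assms(3)[of "insert j S" k] by (simp add: insert_commute)
    show "g (insert j (insert k S)) + g S \<le> g (insert j S) + g (insert k S)"
      using assms(1) jk unfolding submodular_def by blast
  qed (use assms(2,3) in auto)
  then show "- (1 / (1 + g (insert j (insert k S)))) + - (1 / (1 + g S))
      \<le> - (1 / (1 + g (insert j S))) + - (1 / (1 + g (insert k S)))"
    by linarith
qed

lemma submodular_weighted_sum:
  fixes h :: "'i \<Rightarrow> 'a set \<Rightarrow> real"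
  assumes "\<And>i. i \<in> I \<Longrightarrow> 0 \<le> q i" and "\<And>i. i \<in> I \<Longrightarrow> submodular (h i)"
  shows "submodular (\<lambda>S. c + (\<Sum>i\<in>I. q i * h i S))"
  unfolding submodular_def
proof (intro allI impI)
  fix S :: "'a set" and j k :: 'a
  assume jk: "j \<notin> S" "k \<notin> S" "j \<noteq> k"
  have "(\<Sum>i\<in>I. q i * (h i (insert j (insert k S)) + h i S))
      \<le> (\<Sum>i\<in>I. q i * (h i (insert j S) + h i (insert k S)))"
    using assms jk unfolding submodular_def by (intro sum_mono mult_left_mono) blast+
  then show "c + (\<Sum>i\<in>I. q i * h i (insert j (insert k S))) + (c + (\<Sum>i\<in>I. q i * h i S))
      \<le> c + (\<Sum>i\<in>I. q i * h i (insert j S)) + (c + (\<Sum>i\<in>I. q i * h i (insert k S)))"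
    by (simp add: distrib_left sum.distrib)
qed

lemma cpgf_restrict_nonneg:
  assumes "cpgf G" and "Y \<in> nonneg_orthant"
  shows "0 \<le> G (restrict_to S Y)"
  using assms restrict_to_nonneg unfolding cpgf_def by blast

lemma exp_in_nonneg_orthant: "(\<chi> j. exp (w j)) \<in> nonneg_orthant"
  by (simp add: nonneg_orthant_def)

lemma f_gev_mono:
  fixes v :: "'i \<Rightarrow> 'm::finite \<Rightarrow> real"
  assumes "\<And>i. i \<in> I \<Longrightarrow> 0 \<le> q i" and "\<And>i. i \<in> I \<Longrightarrow> cpgf (G i)"
  shows "mono (f_gev I q v G)"
proof (rule mono_if_insert)
  fix S :: "'m set" and j :: 'm
  have "q i / (1 + G i (restrict_to (insert j S) (\<chi> j. exp (v i j))))
      \<le> q i / (1 + G i (restrict_to S (\<chi> j. exp (v i j))))" if "i \<in> I" for i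
    using assms(1,2)[OF that]
      cpgf_restrict_insert_mono[OF assms(2)[OF that] exp_in_nonneg_orthant]
      cpgf_restrict_nonneg[OF assms(2)[OF that] exp_in_nonneg_orthant]
    by (intro divide_left_mono mult_pos_pos add_pos_nonneg add_left_mono) auto
  then show "f_gev I q v G S \<le> f_gev I q v G (insert j S)"
    unfolding f_gev_def by (intro diff_left_mono sum_mono) auto
qed

lemma f_gev_submodular:
  assumes "\<And>i. i \<in> I \<Longrightarrow> 0 \<le> q i" and "\<And>i. i \<in> I \<Longrightarrow> cpgf (G i)"
  shows "submodular (f_gev I q v G)"
proof -
  have "submodular (\<lambda>S. - (1 / (1 + G i (restrict_to S (\<chi> j. exp (v i j))))))" if "i \<in> I" for i
    by (rule submodular_saturation[OF submodular_cpgf_restrict cpgf_restrict_nonneg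
          cpgf_restrict_insert_mono]) (rule assms(2)[OF that] exp_in_nonneg_orthant)+
  then have "submodular (\<lambda>S. (\<Sum>i\<in>I. q i)
      + (\<Sum>i\<in>I. q i * - (1 / (1 + G i (restrict_to S (\<chi> j. exp (v i j)))))))"
    using assms(1) by (intro submodular_weighted_sum)
  moreover have "f_gev I q v G = (\<lambda>S. (\<Sum>i\<in>I. q i)
      + (\<Sum>i\<in>I. q i * - (1 / (1 + G i (restrict_to S (\<chi> j. exp (v i j)))))))"
    by (rule ext) (simp add: f_gev_def sum_negf)
  ultimately show ?thesis by simp
qed

lemma f_gev_nonneg:
  assumes "\<And>i. i \<in> I \<Longrightarrow> 0 \<le> q i" and "\<And>i. i \<in> I \<Longrightarrow> cpgf (G i)"
  shows "0 \<le> f_gev I q v G S"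
proof -
  have "q i / (1 + G i (restrict_to S (\<chi> j. exp (v i j)))) \<le> q i" if "i \<in> I" for i
    using assms(1)[OF that] cpgf_restrict_nonneg[OF assms(2)[OF that] exp_in_nonneg_orthant, of S "v i"]
    by (simp add: divide_le_eq mult_le_cancel_left1)
  then show ?thesis
    unfolding f_gev_def by (simp add: sum_mono)
qed

theorem corollary1:
  fixes I :: "'i set"
    and q :: "'i \<Rightarrow> real"
    and v :: "'i \<Rightarrow> 'm::finite \<Rightarrow> real"
    and G :: "'i \<Rightarrow> real ^ 'm \<Rightarrow> real"
    and C :: nat
    and Sbar :: "'m set"
  assumes "finite I" and "I \<noteq> {}"
    and "\<And>i. i \<in> I \<Longrightarrow> 0 < q i"
    and "\<And>i. i \<in> I \<Longrightarrow> cpgf (G i)"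
    and "1 \<le> C" and "C \<le> CARD('m)"
    and "greedy (f_gev I q v G) C Sbar"
  shows "f_gev I q v G Sbar \<ge> (1 - 1 / exp 1) * (MAX S\<in>{S. card S \<le> C}. f_gev I q v G S)"
proof -
  let ?F = "f_gev I q v G"
  have q: "\<And>i. i \<in> I \<Longrightarrow> 0 \<le> q i"
    using assms(3) by (simp add: less_imp_le)
  have "Max (?F ` {S. card S \<le> C}) \<in> ?F ` {S. card S \<le> C}"
    by (intro Max_in) (auto intro: exI[of _ "{}"])
  then obtain T where card_T: "card T \<le> C" and T: "Max (?F ` {S. card S \<le> C}) = ?F T"
    by blast
  have "(1 - 1 / exp 1) * ?F T \<le> ?F Sbar"
    using f_gev_mono[OF q assms(4)] f_gev_submodular[OF q assms(4)] f_gev_nonneg[OF q assms(4)]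
      finite card_T assms(5,7)
    by (rule greedy_approximation)
  then show ?thesis by (simp add: T)
qed

end
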